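(* Let $\mathbf{X}$ be a random variable with values in $\mathbb{Z}$ whose characteristic function $\Phi_{\mathbf{X}}$ has no zeros, let $\{\hat{c}_{\mathbf{X}}[n]\}_{n\in\mathbb{Z}}$ be its complex muculants, and let $k\ge 1$ be an integer. Suppose that $\log\Phi_{\mathbf{X}}$ is $2\pi$-periodic and continuous, that its first $k-1$ derivatives are continuous, and that its $k$-th and $(k+1)$-th derivatives are piecewise continuous. If the $k$-th cumulant $\kappa_{\mathbf{X}}[k]$ exists, then $$\kappa_{\mathbf{X}}[k]=\sum_{n=-\infty}^{\infty}n^k\,\hat{c}_{\mathbf{X}}[n].$$
   Context: $\jmath$ denotes the imaginary unit. For a random variable $\mathbf{X}$ with values in $\mathbb{Z}$, the characteristic function is $\Phi_{\mathbf{X}}(\mu)=\mathbb{E}(e^{\jmath\mu\mathbf{X}})$, $\mu\in\mathbb{R}$. The complex logarithm of $\Phi_{\mathbf{X}}$ is $\log\Phi_{\mathbf{X}}(\mu)=\ln|\Phi_{\mathbf{X}}(\mu)|+\jmath\arg^*(\Phi_{\mathbf{X}}(\mu))$, where $\ln$ is the natural logarithm and $\mu\mapsto\arg^*(\Phi_{\mathbf{X}}(\mu))$ is the continuous (unwrapped) phase of $\Phi_{\mathbf{X}}$, normalized to be $0$ at $\mu=0$ (where $\Phi_{\mathbf{X}}(0)=1$). The complex muculants $\{\hat{c}_{\mathbf{X}}[n]\}_{n\in\mathbb{Z}}$ are the Fourier series coefficients of $\log\Phi_{\mathbf{X}}$ on $[-\pi,\pi]$: $$\hat{c}_{\mathbf{X}}[n]=\frac{1}{2\pi}\int_{-\pi}^{\pi}\log\Phi_{\mathbf{X}}(\mu)\,e^{-\jmath\mu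 n}\,\mathrm{d}\mu .$$ The $k$-th cumulant is $$\kappa_{\mathbf{X}}[k]=\frac{1}{\jmath^k}\,\frac{d^k}{d\mu^k}\log\Phi_{\mathbf{X}}(\mu)\Big|_{\mu=0},$$ and it is said to exist if this derivative at $0$ exists. A function is piecewise continuous if on each bounded interval it is continuous except at finitely many points, at which it has finite one-sided limits; a derivative that is assumed piecewise continuous need not be defined at those points. Doubly infinite sums $\sum_{n=-\infty}^{\infty}$ are understood, as usual for Fourier series, as limits of the symmetric partial sums $\sum_{n=-N}^{N}$ as $N\to\infty$. *)

theory Defs
  imports "HOL-Probability.Probability"
begin

definition char_fun :: "'a measure \<Rightarrow> ('a \<Rightarrow> int) \<Rightarrow> real \<Rightarrow> complex" where
  "char_fun M X = char (distr M borel (\<lambda>\<omega>. real_of_int (X \<omega>)))"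

(* For continuous f without zeros and f 0 = 1 the description is proper: see
   continuous_phase_ex1. *)
definition continuous_phase :: "(real \<Rightarrow> complex) \<Rightarrow> real \<Rightarrow> real" where
  "continuous_phase f = (THE \<theta>. continuous_on UNIV \<theta> \<and> \<theta> 0 = 0 \<and>
     (\<forall>\<mu>. f \<mu> = of_real (cmod (f \<mu>)) * cis (\<theta> \<mu>)))"

lemma continuous_phase_ex1:
  fixes f :: "real \<Rightarrow> complex"
  assumes cont: "continuous_on UNIV f" and nz: "\<And>\<mu>. f \<mu> \<noteq> 0" and f0: "f 0 = 1"
  shows "\<exists>!\<theta>. continuous_on UNIV \<theta> \<and> \<theta> 0 = 0 \<and>
     (\<forall>\<mu>. f \<mu> = of_real (cmod (f \<mu>)) * cis (\<theta> \<mu>))"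
proof (rule ex_ex1I)
  obtain g where g: "continuous_on UNIV g" "\<And>\<mu>. f \<mu> = exp (g \<mu>)"
    using continuous_logarithm_on_contractible[OF cont convex_imp_contractible[OF convex_UNIV]] nz
    by (metis UNIV_I)
  define \<theta> where "\<theta> \<mu> = Im (g \<mu>) - Im (g 0)" for \<mu>
  have e0: "cis (Im (g 0)) = 1"
  proof -
    have "exp (g 0) = 1" using g(2)[of 0] f0 by simp
    moreover from this have "exp (Re (g 0)) = 1" by (metis norm_exp_eq_Re norm_one)
    ultimately show ?thesis by (simp add: exp_eq_polar)
  qed
  have "f \<mu> = of_real (cmod (f \<mu>)) * cis (\<theta> \<mu>)" for \<mu>
    using e0 by (simp add: g(2) \<theta>_def exp_eq_polar[of "g \<mu>"] cis_divide[symmetric] norm_mult)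
  moreover have "continuous_on UNIV \<theta>"
    unfolding \<theta>_def by (intro continuous_intros g)
  ultimately show "\<exists>\<theta>. continuous_on UNIV \<theta> \<and> \<theta> 0 = 0 \<and>
     (\<forall>\<mu>. f \<mu> = of_real (cmod (f \<mu>)) * cis (\<theta> \<mu>))"
    by (intro exI[of _ \<theta>]) (auto simp: \<theta>_def)
next
  fix a b :: "real \<Rightarrow> real"
  assume a: "continuous_on UNIV a \<and> a 0 = 0 \<and> (\<forall>\<mu>. f \<mu> = of_real (cmod (f \<mu>)) * cis (a \<mu>))"
    and b: "continuous_on UNIV b \<and> b 0 = 0 \<and> (\<forall>\<mu>. f \<mu> = of_real (cmod (f \<mu>)) * cis (b \<mu>))"
  have "cis (a \<mu>) = cis (b \<mu>)" for \<mu>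
    using a b nz[of \<mu>]
    by (metis mult_cancel_left norm_eq_zero of_real_eq_0_iff)
  hence "cis (a \<mu> - b \<mu>) = 1" for \<mu>
    by (simp add: cis_divide[symmetric] norm_mult)
  hence Z: "(a \<mu> - b \<mu>) / (2 * pi) \<in> \<int>" for \<mu>
  proof -
    have "cos (a \<mu> - b \<mu>) = 1" using \<open>\<And>\<mu>. cis (a \<mu> - b \<mu>) = 1\<close>[of \<mu>]
      by (metis cis.sel(1) one_complex.sel(1))
    then obtain n :: int where "a \<mu> - b \<mu> = of_int n * 2 * pi"
      by (auto simp: cos_one_2pi_int)
    thus ?thesis by simp
  qed
  have "(\<lambda>\<mu>. (a \<mu> - b \<mu>) / (2 * pi)) constant_on UNIV"
  proof (rule continuous_discrete_range_constant)
    show "connected (UNIV :: real set)" by simp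
    show "continuous_on UNIV (\<lambda>\<mu>. (a \<mu> - b \<mu>) / (2 * pi))"
      using a b by (intro continuous_intros) auto
    fix x :: real
    show "\<exists>e>0. \<forall>y. y \<in> UNIV \<and> (a y - b y) / (2 * pi) \<noteq> (a x - b x) / (2 * pi) \<longrightarrow>
        e \<le> norm ((a y - b y) / (2 * pi) - (a x - b x) / (2 * pi))"
    proof (intro exI[of _ 1] conjI allI impI)
      fix y
      assume "y \<in> UNIV \<and> (a y - b y) / (2 * pi) \<noteq> (a x - b x) / (2 * pi)"
      thus "1 \<le> norm ((a y - b y) / (2 * pi) - (a x - b x) / (2 * pi))"
        unfolding real_norm_def
        by (intro Ints_nonzero_abs_ge1 Ints_diff Z) auto
    qed auto
  qed
  then obtain c where c: "\<And>\<mu>. (a \<mu> - b \<mu>) / (2 * pi) = c"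
    by (auto simp: constant_on_def)
  with c[of 0] a b have "\<And>\<mu>. a \<mu> = b \<mu>" by auto
  thus "a = b" by auto
qed

definition log_char :: "'a measure \<Rightarrow> ('a \<Rightarrow> int) \<Rightarrow> real \<Rightarrow> complex" where
  "log_char M X \<mu> = of_real (ln (cmod (char_fun M X \<mu>)))
     + \<i> * of_real (continuous_phase (char_fun M X) \<mu>)"

definition complex_muculant :: "'a measure \<Rightarrow> ('a \<Rightarrow> int) \<Rightarrow> int \<Rightarrow> complex" where
  "complex_muculant M X n = 1 / (2 * of_real pi) *
     integral {-pi..pi} (\<lambda>\<mu>. log_char M X \<mu> * exp (- \<i> * of_real \<mu> * of_int n))"

(* At a point where the derivative fails to exist, vector_derivative returns an
   unspecified value; whether it exists is recorded by times_differentiable_at. *)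
primrec nth_deriv :: "nat \<Rightarrow> (real \<Rightarrow> complex) \<Rightarrow> real \<Rightarrow> complex" where
  "nth_deriv 0 f = f"
| "nth_deriv (Suc n) f = (\<lambda>x. vector_derivative (nth_deriv n f) (at x))"

primrec times_differentiable_at :: "nat \<Rightarrow> (real \<Rightarrow> complex) \<Rightarrow> real \<Rightarrow> bool" where
  "times_differentiable_at 0 f x \<longleftrightarrow> True"
| "times_differentiable_at (Suc n) f x \<longleftrightarrow>
     (\<forall>\<^sub>F y in nhds x. times_differentiable_at n f y) \<and> nth_deriv n f differentiable (at x)"

definition cumulant :: "'a measure \<Rightarrow> ('a \<Rightarrow> int) \<Rightarrow> nat \<Rightarrow> complex" where
  "cumulant M X k = 1 / \<i> ^ k * nth_deriv k (log_char M X) 0"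

definition cumulant_exists :: "'a measure \<Rightarrow> ('a \<Rightarrow> int) \<Rightarrow> nat \<Rightarrow> bool" where
  "cumulant_exists M X k \<longleftrightarrow> times_differentiable_at k (log_char M X) 0"

definition continuous_nth_deriv :: "nat \<Rightarrow> (real \<Rightarrow> complex) \<Rightarrow> bool" where
  "continuous_nth_deriv n f \<longleftrightarrow>
     (\<forall>x. times_differentiable_at n f x) \<and> continuous_on UNIV (nth_deriv n f)"

(* S collects the points of the interval at which the derivative is undefined or
   discontinuous. The one-sided limits are taken over punctured neighbourhoods, which near x
   contain no further points of this kind, so unspecified values of nth_deriv play no role. *)
definition piecewise_continuous_nth_deriv :: "nat \<Rightarrow> (real \<Rightarrow> complex) \<Rightarrow> bool" where
  "piecewise_continuous_nth_deriv n f \<longleftrightarrow>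
     (\<forall>a b. \<exists>S. finite S \<and>
        (\<forall>x\<in>{a..b} - S. times_differentiable_at n f x \<and> isCont (nth_deriv n f) x) \<and>
        (\<forall>x\<in>S. (\<exists>l. (nth_deriv n f \<longlongrightarrow> l) (at_left x)) \<and>
                (\<exists>r. (nth_deriv n f \<longlongrightarrow> r) (at_right x))))"

end

theory Submission
  imports Defs
begin

text \<open>
  Write \<open>f\<close> for the logarithm of the characteristic function and \<open>g\<close> for its \<open>k\<close>-th derivative.
  The muculants are the Fourier coefficients of \<open>f\<close>. Since \<open>f\<close> is periodic, \<open>k\<close> integrations by
  parts without boundary terms show that \<open>(\<i> n) ^ k\<close> times the \<open>n\<close>-th muculant is the \<open>n\<close>-th
  Fourier coefficient of \<open>g\<close> (\<open>fourier_coeff_nth_deriv\<close>). After division by \<open>\<i> ^ k\<close> the claim is that the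
  Fourier series of \<open>g\<close> converges at \<open>0\<close> to \<open>g 0\<close>.

  In general the series of a piecewise smooth function converges to the mean of the one-sided
  limits. Here \<open>g\<close> has no jump at \<open>0\<close>: existence of the cumulant says that the preceding
  derivative is differentiable at \<open>0\<close>, and by the mean value inequality both one-sided limits of
  \<open>g\<close> are then equal to this derivative (\<open>isCont_nth_deriv_of_piecewise_continuous\<close>). As the next
  derivative is bounded near \<open>0\<close>, moreover \<open>g x - g 0 = O(x)\<close>
  (\<open>nth_deriv_difference_quotient_Bfun\<close>).

  Convergence (\<open>fourier_series_converges_at_0\<close>) follows by an argument without Dirichlet kernel:
  \<open>h x = (g x - g 0) / (cis x - 1)\<close> is bounded, and from \<open>g x - g 0 = h x * cis x - h x\<close> the
  coefficients of \<open>g - g 0\<close> are differences of consecutive coefficients of \<open>h\<close>. The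
  symmetric partial sums telescope, and what remains are two coefficients of \<open>h\<close>, which tend to \<open>0\<close>
  by Bessel's inequality.
\<close>

section \<open>Fourier coefficients of bounded functions\<close>

lemma integrable_bounded_continuous_off_finite:
  fixes f :: "real \<Rightarrow> complex"
  assumes "finite S" and "continuous_on ({a..b} - S) f"
    and "\<And>x. x \<in> {a..b} \<Longrightarrow> norm (f x) \<le> B"
  shows "f integrable_on {a..b}"
proof -
  have neg: "negligible S" using assms(1) by (rule negligible_finite)
  hence lS: "{a..b} - S \<in> sets lebesgue"
    using negligible_imp_sets[OF neg] by (intro sets.Diff) auto
  have "f integrable_on ({a..b} - S)"
  proof (rule measurable_bounded_by_integrable_imp_integrable)
    show "f \<in> borel_measurable (lebesgue_on ({a..b} - S))"
      by (rule continuous_imp_measurable_on_sets_lebesgue[OF assms(2) lS])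
    show "(\<lambda>x. B) integrable_on ({a..b} - S)"
      by (rule integrable_spike_set[of _ "{a..b}"])
         (force, (rule negligible_subset[OF neg], force)+)
  qed (use assms(3) lS in auto)
  thus ?thesis
    by (rule integrable_spike_set) (rule negligible_subset[OF neg], force)+
qed

definition fourier_coeff :: "(real \<Rightarrow> complex) \<Rightarrow> int \<Rightarrow> complex" where
  "fourier_coeff f n = 1 / (2 * of_real pi) * integral {-pi..pi} (\<lambda>x. f x * cis (- of_int n * x))"

lemma cis_int_pi: "cis (- (of_int n * pi)) = cis (of_int n * pi)"
  by (simp add: complex_eq_iff sin_zero_iff_int2)

lemma integral_cis_int:
  "((\<lambda>x. cis (of_int n * x)) has_integral (if n = 0 then 2 * of_real pi else 0)) {-pi..pi}"
proof (cases "n = 0")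
  case True
  thus ?thesis using has_integral_const_real[of "1 :: complex" "-pi" pi] by (simp add: scaleR_conv_of_real)
next
  case False
  have "((\<lambda>x. cis (of_int n * x)) has_integral
      (cis (of_int n * pi) / (\<i> * of_int n) - cis (of_int n * (-pi)) / (\<i> * of_int n))) {-pi..pi}"
  proof (rule fundamental_theorem_of_calculus)
    fix x
    show "((\<lambda>x. cis (of_int n * x) / (\<i> * of_int n)) has_vector_derivative cis (of_int n * x))
        (at x within {-pi..pi})"
      using False unfolding has_vector_derivative_def
      by (auto intro!: derivative_eq_intros simp: scaleR_conv_of_real field_simps)
  qed auto
  thus ?thesis using False by (simp add: cis_int_pi)
qed

text \<open>
  With \<open>P\<close> the sum of the terms of the Fourier series indexed by \<open>F\<close>, orthogonality of the
  exponentials gives \<open>0 \<le> \<integral> |h - P|\<^sup>2 = \<integral> |h|\<^sup>2 - 2 \<pi> \<Sum> |c n|\<^sup>2\<close>.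
\<close>

lemma bessel_inequality:
  fixes h :: "real \<Rightarrow> complex"
  assumes S: "finite S" and cont: "continuous_on ({-pi..pi} - S) h"
    and B: "\<And>x. x \<in> {-pi..pi} \<Longrightarrow> norm (h x) \<le> B" and F: "finite F"
  shows "(\<Sum>n\<in>F. (cmod (fourier_coeff h n))\<^sup>2) \<le> B\<^sup>2"
proof -
  let ?I = "{-pi..pi}"
  define c where "c = fourier_coeff h"
  define P where "P x = (\<Sum>n\<in>F. c n * cis (of_int n * x))" for x
  have B0: "B \<ge> 0" using B[of 0] norm_ge_zero[of "h 0"] by (simp del: norm_ge_zero)
  have int1: "((\<lambda>x. h x * cis (- of_int n * x)) has_integral (2 * of_real pi * c n)) ?I" for n
  proof -
    have "(\<lambda>x. h x * cis (- of_int n * x)) integrable_on ?I"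
      by (rule integrable_bounded_continuous_off_finite[OF S, where B=B])
         (use B in \<open>auto intro!: continuous_intros cont simp: norm_mult\<close>)
    thus ?thesis unfolding c_def fourier_coeff_def by (simp add: has_integral_integral)
  qed
  have int2: "((\<lambda>x. cnj (h x) * cis (of_int n * x)) has_integral (2 * of_real pi * cnj (c n))) ?I" for n
    using has_integral_cnj[of "\<lambda>x. h x * cis (- of_int n * x)" "2 * of_real pi * c n" ?I] int1[of n]
    by (simp add: o_def cis_cnj)
  have hh: "(\<lambda>x. h x * cnj (h x)) integrable_on ?I"
    by (rule integrable_bounded_continuous_off_finite[OF S, where B="B * B"])
       (use B B0 in \<open>auto intro!: continuous_intros cont mult_mono simp: norm_mult\<close>)
  then obtain Q where Q: "((\<lambda>x. h x * cnj (h x)) has_integral Q) ?I" by blast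
  have "Re Q \<le> 2 * pi * B\<^sup>2"
  proof -
    have "((\<lambda>x. Re (h x * cnj (h x))) has_integral Re Q) ?I" using Q by (rule has_integral_Re)
    moreover have "((\<lambda>x::real. B\<^sup>2) has_integral (2 * pi * B\<^sup>2)) ?I"
      using has_integral_const_real[of "B\<^sup>2" "-pi" pi] by simp
    ultimately show ?thesis
    proof (rule has_integral_le)
      fix x assume "x \<in> ?I"
      have "Re (h x * cnj (h x)) = (cmod (h x))\<^sup>2"
        by (simp only: complex_norm_square[symmetric] Re_complex_of_real)
      thus "Re (h x * cnj (h x)) \<le> B\<^sup>2" using B[OF \<open>x \<in> ?I\<close>] by (simp add: power_mono)
    qed
  qed
  have "((\<lambda>x. h x * cnj (h x) - (\<Sum>n\<in>F. cnj (c n) * (h x * cis (- of_int n * x)))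
       - (\<Sum>n\<in>F. c n * (cnj (h x) * cis (of_int n * x)))
       + (\<Sum>n\<in>F. \<Sum>m\<in>F. c n * cnj (c m) * cis (of_int (n - m) * x))) has_integral
      (Q - (\<Sum>n\<in>F. cnj (c n) * (2 * of_real pi * c n)) - (\<Sum>n\<in>F. c n * (2 * of_real pi * cnj (c n)))
       + (\<Sum>n\<in>F. \<Sum>m\<in>F. c n * cnj (c m) * (if n - m = 0 then 2 * of_real pi else 0)))) ?I"
    by (intro has_integral_add has_integral_diff Q has_integral_sum F has_integral_mult_right
        int1 int2 integral_cis_int)
  moreover have "(\<Sum>n\<in>F. \<Sum>m\<in>F. c n * cnj (c m) * (if n - m = 0 then 2 * of_real pi else 0))
     = (\<Sum>n\<in>F. c n * (2 * of_real pi * cnj (c n)))"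
    using F by (intro sum.cong) (simp_all add: if_distrib cong: if_cong)
  moreover have "h x * cnj (h x) - (\<Sum>n\<in>F. cnj (c n) * (h x * cis (- of_int n * x)))
       - (\<Sum>n\<in>F. c n * (cnj (h x) * cis (of_int n * x)))
       + (\<Sum>n\<in>F. \<Sum>m\<in>F. c n * cnj (c m) * cis (of_int (n - m) * x))
      = of_real ((cmod (h x - P x))\<^sup>2)" for x
  proof -
    have cnjP: "cnj (P x) = (\<Sum>n\<in>F. cnj (c n) * cis (- of_int n * x))"
      by (simp add: P_def cis_cnj)
    have "(\<Sum>n\<in>F. \<Sum>m\<in>F. c n * cnj (c m) * cis (of_int (n - m) * x)) = P x * cnj (P x)"
      unfolding P_def cnjP[unfolded P_def] sum_product
      by (intro sum.cong refl) (simp add: cis_mult left_diff_distrib)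
    moreover have "(\<Sum>n\<in>F. cnj (c n) * (h x * cis (- of_int n * x))) = h x * cnj (P x)"
      by (simp add: cnjP sum_distrib_left mult_ac)
    moreover have "(\<Sum>n\<in>F. c n * (cnj (h x) * cis (of_int n * x))) = cnj (h x) * P x"
      by (simp add: P_def sum_distrib_left mult_ac)
    ultimately show ?thesis
      unfolding complex_norm_square by (simp add: algebra_simps)
  qed
  ultimately have "((\<lambda>x. of_real ((cmod (h x - P x))\<^sup>2)) has_integral
      (Q - (\<Sum>n\<in>F. cnj (c n) * (2 * of_real pi * c n)))) ?I"
    by simp
  from has_integral_Re[OF this]
  have "0 \<le> Re (Q - (\<Sum>n\<in>F. cnj (c n) * (2 * of_real pi * c n)))"
    by (rule has_integral_nonneg) auto
  also have "(\<Sum>n\<in>F. cnj (c n) * (2 * of_real pi * c n)) = of_real (2 * pi * (\<Sum>n\<in>F. (cmod (c n))\<^sup>2))"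
    unfolding of_real_mult of_real_sum complex_norm_square by (simp add: sum_distrib_left mult_ac)
  finally have "2 * pi * (\<Sum>n\<in>F. (cmod (c n))\<^sup>2) \<le> Re Q" by simp
  with \<open>Re Q \<le> 2 * pi * B\<^sup>2\<close> have "2 * pi * (\<Sum>n\<in>F. (cmod (c n))\<^sup>2) \<le> 2 * pi * B\<^sup>2" by linarith
  thus ?thesis unfolding c_def by simp
qed

text \<open>
  Bessel's inequality makes the squared moduli summable along any sequence of distinct
  frequencies.
\<close>

lemma riemann_lebesgue:
  fixes h :: "real \<Rightarrow> complex" and s :: "nat \<Rightarrow> int"
  assumes S: "finite S" and cont: "continuous_on ({-pi..pi} - S) h"
    and B: "\<And>x. x \<in> {-pi..pi} \<Longrightarrow> norm (h x) \<le> B" and s: "inj s"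
  shows "(\<lambda>N. fourier_coeff h (s N)) \<longlonglongrightarrow> 0"
proof -
  have "(\<Sum>i<n. (cmod (fourier_coeff h (s i)))\<^sup>2) \<le> B\<^sup>2" for n
    using bessel_inequality[OF S cont B, of "s ` {..<n}"] inj_on_subset[OF s]
    by (simp add: sum.reindex)
  hence "summable (\<lambda>i. (cmod (fourier_coeff h (s i)))\<^sup>2)"
    by (intro summableI_nonneg_bounded[where x="B\<^sup>2"]) auto
  from tendsto_real_sqrt[OF summable_LIMSEQ_zero[OF this]] show ?thesis
    by (simp add: tendsto_norm_zero_iff)
qed

text \<open>
  The values at the points themselves, which \<open>Bfun f (at x)\<close> leaves free, only change the
  local bounds; finitely many of these suffice by compactness.
\<close>

lemma bounded_if_locally_bounded:
  fixes f :: "real \<Rightarrow> 'a::real_normed_vector"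
  assumes "\<And>x. x \<in> {a..b} \<Longrightarrow> Bfun f (at x)"
  obtains B where "\<And>x. x \<in> {a..b} \<Longrightarrow> norm (f x) \<le> B"
proof -
  have "\<exists>U K. x \<in> U \<and> open U \<and> (\<forall>y\<in>U. norm (f y) \<le> K)" if x: "x \<in> {a..b}" for x
  proof -
    obtain K U where "open U" "x \<in> U" "\<forall>y\<in>U. y \<noteq> x \<longrightarrow> norm (f y) \<le> K"
      using assms[OF x] unfolding Bfun_def eventually_at_topological by auto
    thus ?thesis
      by (intro exI[of _ U] exI[of _ "max K (norm (f x))"]) (auto simp: le_max_iff_disj)
  qed
  then obtain U K where U: "\<And>x. x \<in> {a..b} \<Longrightarrow> x \<in> U x \<and> open (U x) \<and> (\<forall>y\<in>U x. norm (f y) \<le> K x)"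
    by metis
  obtain C where C: "C \<subseteq> {a..b}" "finite C" "{a..b} \<subseteq> (\<Union>x\<in>C. U x)"
    using compactE_image[OF compact_Icc, of "{a..b}" U a b] U by (metis UN_I subsetI)
  show ?thesis
  proof (rule that[of "\<Sum>x\<in>C. \<bar>K x\<bar>"])
    fix y assume "y \<in> {a..b}"
    then obtain x where x: "x \<in> C" "y \<in> U x" using C by blast
    hence "norm (f y) \<le> K x" using U[of x] C(1) by blast
    also have "K x \<le> \<bar>K x\<bar>" by simp
    also have "\<dots> \<le> (\<Sum>x\<in>C. \<bar>K x\<bar>)" using C x by (intro member_le_sum) auto
    finally show "norm (f y) \<le> (\<Sum>x\<in>C. \<bar>K x\<bar>)" .
  qed
qed

lemma Bfun_mult:
  fixes f g :: "'b \<Rightarrow> 'a::real_normed_algebra"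
  assumes "Bfun f F" "Bfun g F"
  shows "Bfun (\<lambda>x. f x * g x) F"
proof -
  obtain K L where "K > 0" and K: "\<forall>\<^sub>F x in F. norm (f x) \<le> K"
    and "L > 0" and L: "\<forall>\<^sub>F x in F. norm (g x) \<le> L"
    using assms unfolding Bfun_def by blast
  from K L have "\<forall>\<^sub>F x in F. norm (f x * g x) \<le> K * L"
  proof eventually_elim
    case (elim x)
    hence "norm (f x) * norm (g x) \<le> K * L" using \<open>K > 0\<close> by (intro mult_mono) auto
    thus ?case using norm_mult_ineq order_trans by blast
  qed
  thus ?thesis by (rule BfunI)
qed

lemma tendsto_imp_Bfun:
  fixes f :: "'b \<Rightarrow> 'a::real_normed_vector"
  assumes "(f \<longlongrightarrow> l) F"
  shows "Bfun f F"
proof -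
  have "\<forall>\<^sub>F x in F. norm (f x) < norm l + 1"
    using tendsto_norm[OF assms] by (rule order_tendstoD) simp
  hence "\<forall>\<^sub>F x in F. norm (f x) \<le> norm l + 1"
    by (rule eventually_mono) simp
  thus ?thesis by (rule BfunI)
qed

lemma difference_quotient_tendsto:
  fixes f :: "real \<Rightarrow> complex"
  assumes "(f has_vector_derivative D) (at x)"
  shows "((\<lambda>y. (f y - f x) / of_real (y - x)) \<longlongrightarrow> D) (at x)"
proof -
  have "((\<lambda>y. cmod (f y - f x - of_real (y - x) * D) / \<bar>y - x\<bar>) \<longlongrightarrow> 0) (at x)"
    using assms by (simp add: has_vector_derivative_def has_derivative_iff_norm scaleR_conv_of_real)
  hence "((\<lambda>y. cmod ((f y - f x) / of_real (y - x) - D)) \<longlongrightarrow> 0) (at x)"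
  proof (rule Lim_transform_eventually)
    show "\<forall>\<^sub>F y in at x. cmod (f y - f x - of_real (y - x) * D) / \<bar>y - x\<bar>
        = cmod ((f y - f x) / of_real (y - x) - D)"
      unfolding eventually_at_filter
    proof (intro always_eventually allI impI)
      fix y :: real assume "y \<noteq> x"
      hence "(f y - f x) / of_real (y - x) - D = (f y - f x - of_real (y - x) * D) / of_real (y - x)"
        by (simp add: field_simps del: of_real_diff)
      thus "cmod (f y - f x - of_real (y - x) * D) / \<bar>y - x\<bar>
          = cmod ((f y - f x) / of_real (y - x) - D)"
        by (simp only: norm_divide norm_of_real)
    qed
  qed
  thus ?thesis by (simp only: tendsto_norm_zero_iff LIM_zero_iff)
qed

lemma fourier_sum_telescope:
  fixes u :: "int \<Rightarrow> 'a::ab_group_add"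
  shows "(\<Sum>n = -int N..int N. u (n - 1) - u n) = u (- int N - 1) - u (int N)"
proof (induction N)
  case (Suc N)
  have "{-int (Suc N)..int (Suc N)} = insert (int N + 1) (insert (- int N - 1) {-int N..int N})" by auto
  thus ?case using Suc by (simp add: algebra_simps)
qed simp

text \<open>
  On \<open>[-\<pi>, \<pi>]\<close> the function \<open>cis x - 1\<close> vanishes only at \<open>0\<close>, and to first order there, so
  the bound on \<open>(g x - L) / x\<close> is what makes \<open>h x = (g x - L) / (cis x - 1)\<close> bounded near \<open>0\<close>.
\<close>

lemma fourier_series_converges_at_0:
  fixes g :: "real \<Rightarrow> complex"
  assumes S: "finite S" and cont: "continuous_on ({-pi..pi} - S) g"
    and bdd: "\<And>x. Bfun g (at x)"
    and lip: "Bfun (\<lambda>x. (g x - L) / of_real x) (at 0)"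
  shows "(\<lambda>N. \<Sum>n = -int N..int N. fourier_coeff g n) \<longlonglongrightarrow> L"
proof -
  let ?I = "{-pi..pi}"
  define h where "h x = (g x - L) / (cis x - 1)" for x
  have cis1: "cis x \<noteq> 1" if "x \<in> ?I" "x \<noteq> 0" for x
  proof
    assume "cis x = 1"
    hence "cos x = 1" by (metis cis.sel(1) one_complex.sel(1))
    then obtain n :: int where n: "x = of_int n * 2 * pi" by (auto simp: cos_one_2pi_int)
    with that have "\<bar>real_of_int n\<bar> * (2 * pi) \<le> 1 * pi" by (auto simp: abs_mult)
    hence "n = 0"
      using mult_right_mono[of 1 "\<bar>real_of_int n\<bar>" "2 * pi"] pi_gt_zero by (cases "n = 0") linarith+
    with n that show False by simp
  qed
  have hb: "Bfun h (at x)" if "x \<in> ?I" for x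
  proof (cases "x = 0")
    case True
    have "((\<lambda>x. (cis x - 1) / of_real x) \<longlongrightarrow> \<i>) (at 0)"
    proof -
      have "(cis has_vector_derivative \<i>) (at 0)"
        unfolding has_vector_derivative_def
        by (auto intro!: derivative_eq_intros)
      from difference_quotient_tendsto[OF this] show ?thesis by simp
    qed
    from tendsto_inverse[OF this] have "Bfun (\<lambda>x. of_real x / (cis x - 1)) (at 0)"
      by (intro tendsto_imp_Bfun) simp_all
    from Bfun_mult[OF lip this] have "Bfun (\<lambda>x. (g x - L) / of_real x * (of_real x / (cis x - 1))) (at 0)" .
    thus ?thesis unfolding Bfun_def h_def True
      by (auto elim!: eventually_mono intro!: exI simp: eventually_at_filter)
  next
    case False
    have "((\<lambda>x. inverse (cis x - 1)) \<longlongrightarrow> inverse (cis x - 1)) (at x)"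
      using cis1[OF that False] by (intro tendsto_intros) auto
    moreover have "Bfun (\<lambda>x. g x - L) (at x)"
      using bdd[of x] unfolding Bfun_def
    proof (elim exE conjE)
      fix K assume "K > 0" "\<forall>\<^sub>F x in at x. norm (g x) \<le> K"
      thus "\<exists>K>0. \<forall>\<^sub>F x in at x. norm (g x - L) \<le> K"
        by (intro exI[of _ "K + norm L"])
           (auto elim!: eventually_mono intro: order_trans[OF norm_triangle_ineq4] add_pos_nonneg)
    qed
    ultimately show ?thesis unfolding h_def divide_inverse
      by (intro Bfun_mult[OF _ tendsto_imp_Bfun])
  qed
  obtain B where B: "\<And>x. x \<in> ?I \<Longrightarrow> norm (h x) \<le> B"
    using bounded_if_locally_bounded[OF hb] by blast
  have S0: "finite (insert 0 S)" using S by simp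
  have conth: "continuous_on (?I - insert 0 S) h"
    unfolding h_def using cis1
    by (intro continuous_intros continuous_on_subset[OF cont]) auto
  have inth: "(\<lambda>x. h x * cis (- of_int n * x)) integrable_on ?I" for n
    by (rule integrable_bounded_continuous_off_finite[OF S0, where B=B])
       (use B in \<open>auto intro!: continuous_intros conth simp: norm_mult\<close>)
  \<comment> \<open>Multiplication by \<open>cis x\<close> shifts the Fourier coefficients by one.\<close>
  have key: "fourier_coeff g n = (if n = 0 then L else 0) + (fourier_coeff h (n - 1) - fourier_coeff h n)" for n
  proof -
    have "((\<lambda>x. L * cis (of_int (-n) * x) + (h x * cis (- of_int (n - 1) * x) - h x * cis (- of_int n * x)))
      has_integral (L * (if -n = 0 then 2 * of_real pi else 0) +
        (integral ?I (\<lambda>x. h x * cis (- of_int (n - 1) * x)) - integral ?I (\<lambda>x. h x * cis (- of_int n * x))))) ?I"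
      by (intro has_integral_add has_integral_diff has_integral_mult_right integral_cis_int
          integrable_integral inth)
    hence "((\<lambda>x. g x * cis (- of_int n * x))
      has_integral (L * (if -n = 0 then 2 * of_real pi else 0) +
        (integral ?I (\<lambda>x. h x * cis (- of_int (n - 1) * x)) - integral ?I (\<lambda>x. h x * cis (- of_int n * x))))) ?I"
    proof (rule has_integral_spike_finite[of "{0}", rotated 2])
      fix x assume x: "x \<in> ?I - {0}"
      have "cis (- of_int (n - 1) * x) = cis x * cis (- of_int n * x)"
        by (simp add: cis_mult algebra_simps)
      moreover have "h x * (cis x - 1) = g x - L"
        using cis1[of x] x by (simp add: h_def)
      hence "g x = L + (h x * cis x - h x)" by (simp add: algebra_simps)
      ultimately show "g x * cis (- of_int n * x) = L * cis (of_int (-n) * x) +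
          (h x * cis (- of_int (n - 1) * x) - h x * cis (- of_int n * x))"
        by (simp only: of_int_minus) (simp only: algebra_simps)
    qed simp
    from integral_unique[OF this] show ?thesis
      unfolding fourier_coeff_def by (simp add: field_simps)
  qed
  have "(\<Sum>n = -int N..int N. fourier_coeff g n) = L + (fourier_coeff h (- int N - 1) - fourier_coeff h (int N))" for N
    by (simp add: key sum.distrib fourier_sum_telescope)
  moreover have "(\<lambda>N. L + (fourier_coeff h (- int N - 1) - fourier_coeff h (int N))) \<longlonglongrightarrow> L + (0 - 0)"
    by (intro tendsto_intros riemann_lebesgue[OF S0 conth B]) (auto intro!: injI)
  ultimately show ?thesis by simp
qed

section \<open>Fourier coefficients of derivatives\<close>

text \<open>
  Integration by parts. The fundamental theorem of calculus tolerates finitely many points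
  without derivative because \<open>g\<close> is continuous there, and the integrability of \<open>g'\<close> is part
  of its conclusion.
\<close>

lemma fourier_coeff_derivative:
  fixes g :: "real \<Rightarrow> complex"
  assumes S: "finite S" and cont: "continuous_on {-pi..pi} g"
    and der: "\<And>x. x \<in> {-pi..pi} - S \<Longrightarrow> (g has_vector_derivative g' x) (at x)"
    and per: "g pi = g (-pi)"
  shows "fourier_coeff g' n = \<i> * of_int n * fourier_coeff g n"
proof -
  let ?I = "{-pi..pi}" and ?e = "\<lambda>x. cis (- of_int n * x)"
  have "((\<lambda>x. g' x * ?e x - \<i> * of_int n * (g x * ?e x)) has_integral (g pi * ?e pi - g (-pi) * ?e (-pi))) ?I"
  proof (rule fundamental_theorem_of_calculus_strong[OF S])
    fix x assume "x \<in> ?I - S"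
    moreover have "(?e has_vector_derivative - \<i> * of_int n * ?e x) (at x)"
      unfolding has_vector_derivative_def
      by (auto intro!: derivative_eq_intros simp: scaleR_conv_of_real)
    ultimately have "((\<lambda>x. g x * ?e x) has_vector_derivative (g x * (- \<i> * of_int n * ?e x) + g' x * ?e x)) (at x)"
      by (intro has_vector_derivative_mult der)
    thus "((\<lambda>x. g x * ?e x) has_vector_derivative (g' x * ?e x - \<i> * of_int n * (g x * ?e x))) (at x)"
      by (simp add: algebra_simps)
  qed (auto intro!: continuous_intros cont)
  hence "((\<lambda>x. g' x * ?e x - \<i> * of_int n * (g x * ?e x)) has_integral 0) ?I"
    using per by (simp add: cis_int_pi)
  moreover have "((\<lambda>x. \<i> * of_int n * (g x * ?e x)) has_integral \<i> * of_int n * integral ?I (\<lambda>x. g x * ?e x)) ?I"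
    by (intro has_integral_mult_right integrable_integral integrable_continuous_interval
        continuous_intros cont)
  ultimately have "((\<lambda>x. (g' x * ?e x - \<i> * of_int n * (g x * ?e x)) + \<i> * of_int n * (g x * ?e x)) has_integral
      (0 + \<i> * of_int n * integral ?I (\<lambda>x. g x * ?e x))) ?I"
    by (rule has_integral_add)
  hence "integral ?I (\<lambda>x. g' x * ?e x) = \<i> * of_int n * integral ?I (\<lambda>x. g x * ?e x)"
    by (intro integral_unique) simp
  thus ?thesis by (simp add: fourier_coeff_def)
qed

lemma has_vector_derivative_shift_iff:
  "(f has_vector_derivative D) (at (x + p :: real)) \<longleftrightarrow>
   ((\<lambda>y. f (y + p)) has_vector_derivative D) (at x)"
proof
  assume "(f has_vector_derivative D) (at (x + p))"
  moreover have "((\<lambda>y. y + p) has_vector_derivative 1) (at x)"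
    by (auto intro!: derivative_eq_intros)
  ultimately show "((\<lambda>y. f (y + p)) has_vector_derivative D) (at x)"
    using vector_diff_chain_at[of "\<lambda>y. y + p" 1 x f D] by (simp add: o_def)
next
  assume "((\<lambda>y. f (y + p)) has_vector_derivative D) (at x)"
  moreover have "((\<lambda>y. y - p) has_vector_derivative 1) (at (x + p))"
    by (auto intro!: derivative_eq_intros)
  ultimately show "(f has_vector_derivative D) (at (x + p))"
    using vector_diff_chain_at[of "\<lambda>y. y - p" 1 "x + p" "\<lambda>y. f (y + p)" D] by (simp add: o_def)
qed

text \<open>
  At shifted points the sets of possible derivatives coincide, hence so does the value that
  \<open>vector_derivative\<close> selects, even where this set is empty.
\<close>

lemma nth_deriv_periodic:
  assumes "\<And>x. f (x + p) = f x"
  shows "nth_deriv n f (x + p) = nth_deriv n f x"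
proof (induction n arbitrary: x)
  case (Suc n)
  thus ?case
    by (simp add: vector_derivative_def has_vector_derivative_shift_iff)
qed (simp add: assms)

lemma nth_deriv_has_derivative:
  assumes "times_differentiable_at (Suc n) f x"
  shows "(nth_deriv n f has_vector_derivative nth_deriv (Suc n) f x) (at x)"
  using assms by (simp add: vector_derivative_works)

lemma fourier_coeff_nth_deriv:
  assumes per: "\<And>x. f (x + 2 * pi) = f x"
    and cont: "\<And>i. i < j \<Longrightarrow> continuous_on UNIV (nth_deriv i f)"
    and diff: "\<And>i. i < j \<Longrightarrow> \<exists>S. finite S \<and> (\<forall>x\<in>{-pi..pi} - S. times_differentiable_at (Suc i) f x)"
  shows "fourier_coeff (nth_deriv j f) n = (\<i> * of_int n) ^ j * fourier_coeff f n"
  using cont diff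
proof (induction j)
  case (Suc j)
  obtain S where S: "finite S" "\<And>x. x \<in> {-pi..pi} - S \<Longrightarrow> times_differentiable_at (Suc j) f x"
    using Suc.prems(2)[of j] by auto
  have "fourier_coeff (nth_deriv (Suc j) f) n = \<i> * of_int n * fourier_coeff (nth_deriv j f) n"
  proof (rule fourier_coeff_derivative[OF S(1)])
    show "continuous_on {-pi..pi} (nth_deriv j f)"
      using Suc.prems(1)[of j] by (auto intro: continuous_on_subset)
    show "nth_deriv j f pi = nth_deriv j f (-pi)"
      using nth_deriv_periodic[of f "2 * pi" j "-pi"] per by simp
  qed (use S(2) in \<open>rule nth_deriv_has_derivative\<close>)
  thus ?case using Suc by (simp del: nth_deriv.simps)
qed simp

section \<open>Piecewise continuous derivatives near a point\<close>

lemma piecewise_continuous_nth_deriv_eventually: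
  assumes "piecewise_continuous_nth_deriv n f"
  shows "\<forall>\<^sub>F y in at x. times_differentiable_at n f y \<and> isCont (nth_deriv n f) y"
proof -
  obtain S where S: "finite S" and
    *: "\<forall>y\<in>{x-1..x+1} - S. times_differentiable_at n f y \<and> isCont (nth_deriv n f) y"
    using assms unfolding piecewise_continuous_nth_deriv_def by blast
  have "open ({x-1<..<x+1} - (S - {x}))"
    using S by (intro open_Diff finite_imp_closed) auto
  moreover have "x \<in> {x-1<..<x+1} - (S - {x})" by simp
  ultimately show ?thesis
    unfolding eventually_at_topological using *
    by (intro exI[of _ "{x-1<..<x+1} - (S - {x})"]) auto
qed

lemma piecewise_continuous_nth_deriv_one_sided_limits:
  assumes "piecewise_continuous_nth_deriv n f"
  obtains l r where "(nth_deriv n f \<longlongrightarrow> l) (at_left x)" "(nth_deriv n f \<longlongrightarrow> r) (at_right x)"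
proof -
  from assms obtain S where
    S: "\<forall>y\<in>{x..x} - S. times_differentiable_at n f y \<and> isCont (nth_deriv n f) y"
    "\<forall>y\<in>S. (\<exists>l. (nth_deriv n f \<longlongrightarrow> l) (at_left y)) \<and> (\<exists>r. (nth_deriv n f \<longlongrightarrow> r) (at_right y))"
    unfolding piecewise_continuous_nth_deriv_def by meson
  show ?thesis
  proof (cases "x \<in> S")
    case True
    with S(2) obtain l r where "(nth_deriv n f \<longlongrightarrow> l) (at_left x)" "(nth_deriv n f \<longlongrightarrow> r) (at_right x)"
      by meson
    thus ?thesis by (rule that)
  next
    case False
    hence "isCont (nth_deriv n f) x" using S(1) by simp
    hence "(nth_deriv n f \<longlongrightarrow> nth_deriv n f x) (at_left x) \<and> (nth_deriv n f \<longlongrightarrow> nth_deriv n f x) (at_right x)"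
      unfolding isCont_def filterlim_at_split .
    thus ?thesis by (elim conjE) (rule that)
  qed
qed

lemma piecewise_continuous_nth_deriv_Bfun:
  assumes "piecewise_continuous_nth_deriv n f"
  shows "Bfun (nth_deriv n f) (at x)"
proof -
  obtain l r where "(nth_deriv n f \<longlongrightarrow> l) (at_left x)" "(nth_deriv n f \<longlongrightarrow> r) (at_right x)"
    using piecewise_continuous_nth_deriv_one_sided_limits[OF assms] .
  hence "Bfun (nth_deriv n f) (at_left x)" "Bfun (nth_deriv n f) (at_right x)"
    by (auto intro: tendsto_imp_Bfun)
  then obtain K L where "K > 0" and K: "\<forall>\<^sub>F y in at_left x. norm (nth_deriv n f y) \<le> K"
    and L: "\<forall>\<^sub>F y in at_right x. norm (nth_deriv n f y) \<le> L"
    unfolding Bfun_def by blast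
  have "\<forall>\<^sub>F y in at_left x. norm (nth_deriv n f y) \<le> max K L"
    using K by eventually_elim simp
  moreover have "\<forall>\<^sub>F y in at_right x. norm (nth_deriv n f y) \<le> max K L"
    using L by eventually_elim simp
  ultimately have "\<forall>\<^sub>F y in at x. norm (nth_deriv n f y) \<le> max K L"
    unfolding eventually_at_split by (rule conjI)
  thus ?thesis by (rule BfunI)
qed

lemma increment_bound_interval:
  fixes f :: "real \<Rightarrow> 'a::real_inner"
  assumes "a < b" and "isCont f a" and "isCont f b"
    and der: "\<And>z. z \<in> {a<..<b} \<Longrightarrow> (f has_vector_derivative f' z) (at z) \<and> norm (f' z) \<le> K"
  shows "norm (f b - f a) \<le> K * (b - a)"
proof -
  have "isCont f z" if "z \<in> {a..b}" for z
  proof (cases "z = a \<or> z = b")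
    case False
    hence "z \<in> {a<..<b}" using that by auto
    from der[OF this] show ?thesis by (auto intro: has_vector_derivative_continuous)
  qed (use assms in auto)
  hence "continuous_on {a..b} f" by (simp add: continuous_at_imp_continuous_on)
  hence "\<exists>z\<in>{a<..<b}. norm (f b - f a) \<le> norm ((b - a) *\<^sub>R f' z)"
    by (rule mvt_general[OF \<open>a < b\<close>]) (use der in \<open>simp add: has_vector_derivative_def\<close>)
  then obtain z where z: "z \<in> {a<..<b}"
    and "norm (f b - f a) \<le> (b - a) * norm (f' z)"
    using \<open>a < b\<close> by auto
  have "norm (f b - f a) \<le> (b - a) * norm (f' z)" by fact
  also have "(b - a) * norm (f' z) \<le> (b - a) * K"
    using der[OF z] \<open>a < b\<close> by (intro mult_left_mono) simp_all
  finally show ?thesis by (simp only: mult.commute)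
qed

text \<open>
  The set \<open>A\<close> is star-shaped around \<open>x\<close>, so that the two half-lines at \<open>x\<close> and the whole
  line are treated together; \<open>f\<close> may fail to be differentiable at \<open>x\<close> itself.
\<close>

lemma increment_bound_punctured:
  fixes f :: "real \<Rightarrow> 'a::real_inner"
  assumes cont: "isCont f x" and A: "\<And>y. y \<in> A \<Longrightarrow> open_segment x y \<subseteq> A"
    and der: "\<forall>\<^sub>F y in at x within A. (f has_vector_derivative f' y) (at y) \<and> norm (f' y) \<le> K"
  shows "\<forall>\<^sub>F y in at x within A. norm (f y - f x) \<le> K * \<bar>y - x\<bar>"
proof -
  obtain d where "d > 0" and d: "\<forall>y\<in>A. y \<noteq> x \<and> dist y x < d \<longrightarrow>
      (f has_vector_derivative f' y) (at y) \<and> norm (f' y) \<le> K"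
    using der unfolding eventually_at by (elim exE conjE) (rule that)
  have bound: "norm (f y - f x) \<le> K * \<bar>y - x\<bar>" if y: "y \<in> A" "y \<noteq> x" "dist y x < d" for y
  proof -
    have "(f has_vector_derivative f' y) (at y)" using d y by simp
    hence "isCont f y" by (rule has_vector_derivative_continuous)
    consider "x < y" | "y < x" using y by linarith
    then show ?thesis
    proof cases
      case 1
      have "norm (f y - f x) \<le> K * (y - x)"
      proof (rule increment_bound_interval[OF 1 cont \<open>isCont f y\<close>])
        fix z assume z: "z \<in> {x<..<y}"
        hence "z \<in> A" using A[OF y(1)] 1 by (auto simp: open_segment_eq_real_ivl)
        moreover have "z \<noteq> x" "dist z x < d" using z y(3) by (auto simp: dist_real_def)
        ultimately show "(f has_vector_derivative f' z) (at z) \<and> norm (f' z) \<le> K" using d by simp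
      qed
      thus ?thesis using 1 by simp
    next
      case 2
      have "norm (f x - f y) \<le> K * (x - y)"
      proof (rule increment_bound_interval[OF 2 \<open>isCont f y\<close> cont])
        fix z assume z: "z \<in> {y<..<x}"
        hence "z \<in> A" using A[OF y(1)] 2 by (auto simp: open_segment_eq_real_ivl)
        moreover have "z \<noteq> x" "dist z x < d" using z y(3) by (auto simp: dist_real_def)
        ultimately show "(f has_vector_derivative f' z) (at z) \<and> norm (f' z) \<le> K" using d by simp
      qed
      thus ?thesis using 2 by (simp add: norm_minus_commute)
    qed
  qed
  show ?thesis
    unfolding eventually_at using \<open>d > 0\<close>
    by (intro exI[of _ d] conjI ballI impI bound) (assumption | erule conjE)+
qed

lemma norm_difference_quotient_le:
  fixes a :: complex and x y :: real
  assumes "y \<noteq> x"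
  shows "norm (a / of_real (y - x)) \<le> K \<longleftrightarrow> norm a \<le> K * \<bar>y - x\<bar>"
proof -
  have "\<bar>y - x\<bar> > 0" using assms by simp
  thus ?thesis by (simp only: norm_divide norm_of_real pos_divide_le_eq)
qed

text \<open>
  A derivative cannot have a jump: subtracting the linear function with slope \<open>l\<close> leaves a
  function whose derivative is small on \<open>A\<close> near \<open>x\<close>, so by the mean value inequality its
  difference quotients at \<open>x\<close> are small as well, while they converge to \<open>D - l\<close>.
\<close>

lemma derivative_eq_one_sided_limit:
  fixes f :: "real \<Rightarrow> complex"
  assumes D: "(f has_vector_derivative D) (at x)"
    and A: "\<And>y. y \<in> A \<Longrightarrow> open_segment x y \<subseteq> A" and nontriv: "at x within A \<noteq> bot"
    and der: "\<forall>\<^sub>F y in at x within A. (f has_vector_derivative f' y) (at y)"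
    and lim: "(f' \<longlongrightarrow> l) (at x within A)"
  shows "l = D"
proof -
  have small: "norm (D - l) \<le> e" if "e > 0" for e
  proof -
    define F where "F y = f y - of_real y * l" for y
    have derF: "(F has_vector_derivative (E - l)) (at y)" if "(f has_vector_derivative E) (at y)" for y E
    proof -
      have "((\<lambda>y. of_real y * l) has_vector_derivative l) (at y)"
        unfolding has_vector_derivative_def
        by (auto intro!: derivative_eq_intros simp: scaleR_conv_of_real)
      thus ?thesis unfolding F_def using that by (rule has_vector_derivative_diff[rotated])
    qed
    have "\<forall>\<^sub>F y in at x within A. norm (f' y - l) < e"
      using tendstoD[OF lim \<open>e > 0\<close>] by (simp add: dist_norm)
    with der have "\<forall>\<^sub>F y in at x within A. (F has_vector_derivative (f' y - l)) (at y) \<and> norm (f' y - l) \<le> e"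
      by eventually_elim (auto intro: derF)
    with has_vector_derivative_continuous[OF derF[OF D]] A
    have "\<forall>\<^sub>F y in at x within A. norm (F y - F x) \<le> e * \<bar>y - x\<bar>"
      by (rule increment_bound_punctured)
    moreover have "\<forall>\<^sub>F y in at x within A. y \<noteq> x" by (simp add: eventually_at_filter)
    ultimately have ev: "\<forall>\<^sub>F y in at x within A. norm ((F y - F x) / of_real (y - x)) \<le> e"
      by eventually_elim (simp add: norm_difference_quotient_le del: of_real_diff)
    have "((\<lambda>y. norm ((F y - F x) / of_real (y - x))) \<longlongrightarrow> norm (D - l)) (at x within A)"
      using difference_quotient_tendsto[OF derF[OF D]]
      by (intro tendsto_norm) (rule tendsto_within_subset[OF _ subset_UNIV])
    from this ev nontriv show ?thesis by (rule tendsto_upperbound)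
  qed
  have "norm (D - l) \<le> 0"
  proof (rule field_le_epsilon)
    fix e :: real assume "0 < e"
    from small[OF this] show "norm (D - l) \<le> 0 + e" by (simp only: add_0)
  qed
  hence "D - l = 0" by (simp only: norm_le_zero_iff)
  thus ?thesis by (simp only: right_minus_eq)
qed

lemma isCont_nth_deriv_of_piecewise_continuous:
  assumes pc: "piecewise_continuous_nth_deriv (Suc n) f" and diff: "times_differentiable_at (Suc n) f x"
  shows "isCont (nth_deriv (Suc n) f) x"
proof -
  obtain l r where lr: "(nth_deriv (Suc n) f \<longlongrightarrow> l) (at_left x)" "(nth_deriv (Suc n) f \<longlongrightarrow> r) (at_right x)"
    using piecewise_continuous_nth_deriv_one_sided_limits[OF pc] .
  have "\<forall>\<^sub>F y in at x. (nth_deriv n f has_vector_derivative nth_deriv (Suc n) f y) (at y)"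
    using piecewise_continuous_nth_deriv_eventually[OF pc, of x]
    by eventually_elim (elim conjE, rule nth_deriv_has_derivative)
  note left = this[unfolded eventually_at_split, THEN conjunct1]
    and right = this[unfolded eventually_at_split, THEN conjunct2]
  note D = nth_deriv_has_derivative[OF diff]
  have "open_segment x y \<subseteq> {..<x}" if "y \<in> {..<x}" for y
    using that by (simp add: open_segment_eq_real_ivl subset_iff)
  from derivative_eq_one_sided_limit[OF D this trivial_limit_at_left_real left lr(1)]
  have l: "l = nth_deriv (Suc n) f x" .
  have "open_segment x y \<subseteq> {x<..}" if "y \<in> {x<..}" for y
    using that by (simp add: open_segment_eq_real_ivl subset_iff)
  from derivative_eq_one_sided_limit[OF D this trivial_limit_at_right_real right lr(2)]
  have r: "r = nth_deriv (Suc n) f x" .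
  show ?thesis
    unfolding isCont_def filterlim_at_split using lr[unfolded l r] by (rule conjI)
qed

lemma nth_deriv_difference_quotient_Bfun:
  assumes cont: "isCont (nth_deriv n f) x" and pc: "piecewise_continuous_nth_deriv (Suc n) f"
  shows "Bfun (\<lambda>y. (nth_deriv n f y - nth_deriv n f x) / of_real (y - x)) (at x)"
proof -
  obtain K where "\<forall>\<^sub>F y in at x. norm (nth_deriv (Suc n) f y) \<le> K"
    using piecewise_continuous_nth_deriv_Bfun[OF pc] unfolding Bfun_def by blast
  with piecewise_continuous_nth_deriv_eventually[OF pc, of x]
  have "\<forall>\<^sub>F y in at x. (nth_deriv n f has_vector_derivative nth_deriv (Suc n) f y) (at y)
      \<and> norm (nth_deriv (Suc n) f y) \<le> K"
    by eventually_elim (elim conjE, intro conjI nth_deriv_has_derivative)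
  hence "\<forall>\<^sub>F y in at x. norm (nth_deriv n f y - nth_deriv n f x) \<le> K * \<bar>y - x\<bar>"
    by (intro increment_bound_punctured[OF cont]) simp_all
  moreover have "\<forall>\<^sub>F y in at x. y \<noteq> x" by (simp add: eventually_at_filter)
  ultimately have "\<forall>\<^sub>F y in at x. norm ((nth_deriv n f y - nth_deriv n f x) / of_real (y - x)) \<le> K"
    by eventually_elim (simp add: norm_difference_quotient_le del: of_real_diff)
  thus ?thesis by (rule BfunI)
qed

section \<open>Cumulants as sums of muculants\<close>

text \<open>
  It remains to check that the smoothness assumptions allow the integrations by parts: below order
  \<open>k\<close> every derivative is continuous, and only the last step meets exceptional points.
\<close>

theorem mainTheorem3:
  fixes M :: "'a measure" and X :: "'a \<Rightarrow> int" and k :: nat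
  assumes "prob_space M"
    and "X \<in> measurable M (count_space UNIV)"
    and "\<forall>\<mu>. char_fun M X \<mu> \<noteq> 0"
    and "k \<ge> 1"
    and "\<forall>\<mu>. log_char M X (\<mu> + 2 * pi) = log_char M X \<mu>"
    and "continuous_on UNIV (log_char M X)"
    and "\<forall>j\<in>{1..k-1}. continuous_nth_deriv j (log_char M X)"
    and "piecewise_continuous_nth_deriv k (log_char M X)"
    and "piecewise_continuous_nth_deriv (k + 1) (log_char M X)"
    and "cumulant_exists M X k"
  shows "(\<lambda>N::nat. \<Sum>n = -int N..int N. of_int n ^ k * complex_muculant M X n)
           \<longlonglongrightarrow> cumulant M X k"
proof -
  define f where "f = log_char M X"
  define g where "g = nth_deriv k f"
  obtain m where m: "k = Suc m" using \<open>k \<ge> 1\<close> by (cases k) auto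
  have smooth: "\<And>j. 1 \<le> j \<Longrightarrow> j < k \<Longrightarrow> continuous_nth_deriv j f"
    and pc: "piecewise_continuous_nth_deriv k f" and pc': "piecewise_continuous_nth_deriv (Suc k) f"
    and diff0: "times_differentiable_at k f 0"
    using assms(7-10) by (auto simp: f_def cumulant_exists_def)
  obtain S where S: "finite S"
    "\<And>x. x \<in> {-pi..pi} - S \<Longrightarrow> times_differentiable_at k f x \<and> isCont g x"
    using pc unfolding piecewise_continuous_nth_deriv_def g_def by metis

  have muculant: "complex_muculant M X n = fourier_coeff f n" for n
    unfolding complex_muculant_def fourier_coeff_def f_def cis_conv_exp by (simp add: mult_ac)
  have coeff: "fourier_coeff g n = (\<i> * of_int n) ^ k * fourier_coeff f n" for n
    unfolding g_def
  proof (rule fourier_coeff_nth_deriv)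
    show "f (x + 2 * pi) = f x" for x using assms(5) by (simp add: f_def)
    show "continuous_on UNIV (nth_deriv i f)" if "i < k" for i
      using assms(6) smooth[of i] that by (cases i) (auto simp: f_def continuous_nth_deriv_def)
    show "\<exists>S. finite S \<and> (\<forall>x\<in>{-pi..pi} - S. times_differentiable_at (Suc i) f x)" if "i < k" for i
    proof (cases "Suc i = k")
      case True
      thus ?thesis using S by blast
    next
      case False
      thus ?thesis using smooth[of "Suc i"] that
        by (intro exI[of _ "{}"]) (simp add: continuous_nth_deriv_def)
    qed
  qed

  have "isCont g 0"
    using isCont_nth_deriv_of_piecewise_continuous[of m f 0] pc diff0 unfolding g_def m by blast
  have "(\<lambda>N. \<Sum>n = -int N..int N. fourier_coeff g n) \<longlonglongrightarrow> g 0"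
  proof (rule fourier_series_converges_at_0[OF S(1)])
    show "continuous_on ({-pi..pi} - S) g"
      using S(2) by (intro continuous_at_imp_continuous_on) blast
    show "Bfun g (at x)" for x
      unfolding g_def by (rule piecewise_continuous_nth_deriv_Bfun[OF pc])
    show "Bfun (\<lambda>x. (g x - g 0) / of_real x) (at 0)"
      using nth_deriv_difference_quotient_Bfun[OF _ pc', of 0] \<open>isCont g 0\<close> by (simp add: g_def)
  qed
  hence "(\<lambda>N. 1 / \<i> ^ k * (\<Sum>n = -int N..int N. fourier_coeff g n)) \<longlonglongrightarrow> 1 / \<i> ^ k * g 0"
    by (rule tendsto_mult_left)
  moreover have "1 / \<i> ^ k * (\<Sum>n = -int N..int N. fourier_coeff g n)
      = (\<Sum>n = -int N..int N. of_int n ^ k * complex_muculant M X n)" for N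
    by (simp add: coeff muculant sum_distrib_left power_mult_distrib)
  ultimately show ?thesis
    by (simp add: cumulant_def g_def f_def)
qed

end
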